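(* (1) Let $\mathfrak s\in\mathscr S^{\mathbb Z}_r$, with associated multipartition $\underline\gamma_{\mathfrak s}$ and parameter vector $\underline u_{\mathfrak s}=\underline u_f$. Then $\underline\gamma_{\mathfrak s}$ is a sincere standard multipartition relative to $f^*$ (i.e. with respect to $\underline u_{\mathfrak s}^{-1}=\underline u_{f^*}$) and, moreover, the sequence of column residual segments ${\bf s}^{\mathsf c}_{\underline\gamma_{\mathfrak s}';\underline u_{\mathfrak s}}$ is the standard element in $\mathfrak s$. (2) For a given $f\in\mathfrak F$, let $\mathscr S^{\mathbb Z}_{r,f}=\{\mathfrak s\in\mathscr S^{\mathbb Z}_r\mid\underline u_{\mathfrak s}=\underline u_f\}$. Then the map $$\eta_f:\mathscr S^{\mathbb Z}_{r,f}\longrightarrow\mathcal K^s_{f^*}(r),\qquad\mathfrak s\longmapsto\underline\gamma_{\mathfrak s},$$ is a bijection.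
   Context: $q\in\mathbb C^*$ is not a root of unity. **Segments.** An integral segment is a sequence $\mathsf s=(q^{2i},q^{2(i+1)},\dots,q^{2j})$, $i\le j$ in $\mathbb Z$; $|\mathsf s|=j-i+1$. $\mathscr S_r^{\mathbb Z}$ is the set of integral multisegments $\mathfrak s=\{\mathsf s_1,\dots,\mathsf s_t\}$ (multisets of integral segments) with $\sum_k|\mathsf s_k|=r$. A sequence $(\mathsf s_1,\dots,\mathsf s_t)$ with $\mathsf s_k=(q^{2i_k},\dots,q^{2j_k})$ is standard if $j_1\le\cdots\le j_t$ and $i_k\ge i_{k+1}$ whenever $j_k=j_{k+1}$; each $\mathfrak s$ has a unique standard ordering, called the standard element in $\mathfrak s$. **Multipartitions.** A multipartition of $r$ is $\underline\lambda=(\lambda^{(1)},\dots,\lambda^{(m)})$, a tuple of partitions with $\sum|\lambda^{(i)}|=r$; it is sincere if every $|\lambda^{(i)}|>0$. $\underline\lambda'=(\lambda^{(m)\prime},\dots,\lambda^{(1)\prime})$, where $\lambda'$ is the conjugate partition; $\ell(\cdot)$ is the number of nonzero parts. $\mathfrak F_m=\{f\in\mathbb Z^m: f_1\ge\cdots\ge f_m\}$, $\mathfrak F=\bigcup_{m\ge1}\mathfrak F_m$, $f^*=(-f_m,\dots,-f_1)$, $\underline u_f=(q^{2f_1},\dots,q^{2f_m})$. A multipartition $\underline\gamma=(\gamma^{(1)},\dots,\gamma^{(m)})$ of $r$ is standard relative to $f\in\mathfrak F_m$ if: (SK1) $\ell(\gamma^{(a)})\ge1$ for $1\le a\le m$;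 (SK2) $\ell(\gamma^{(a)})\le f_a-f_{a+1}+1$ and $\gamma^{(a)}_{f_a-f_{a+1}+1}\le\gamma^{(a+1)}_1$ for $1\le a\le m-1$; (SK3) if $\ell(\gamma^{(a)})=f_a-f_{a+1}$ for some $1\le a\le m-1$, then $\gamma^{(a)}_{f_a-f_{a+1}}\le\gamma^{(a+1)}_1-1$. $\mathcal K^s_f(r)$ is the set of these. **The pair $(\underline\gamma_{\mathfrak s},\underline u_{\mathfrak s})$.** Write the standard ordering of $\mathfrak s$ with $\mathsf s_k=(q^{2i_k},\dots,q^{2j_k})$, $1\le k\le t$. Let $k_1\in\{1,\dots,t\}$ be the largest index such that $j_a=j_{a-1}+1$ for $2\le a\le k_1$ and $i_1<i_2<\cdots<i_{k_1}$. Put $\gamma^{(1)}_b=j_b-i_b+1$ for $1\le b\le k_1$. Remove the first $k_1$ segments and repeat with the remaining sequence, obtaining $k_2,\gamma^{(2)}$, etc., until nothing remains after $m$ steps. Thus $\gamma^{(a)}=(\gamma^{(a)}_1,\dots,\gamma^{(a)}_{k_a})$ with $\gamma^{(a)}_b=j_{c}-i_{c}+1$, $c=k_1+\cdots+k_{a-1}+b$. Set $\underline\gamma_{\mathfrak s}=(\gamma^{(1)},\dots,\gamma^{(m)})$ and $\underline u_{\mathfrak s}=\underline u_f$ with $f_i=j_{k_1+\cdots+k_{m-i}+1}$ for $1\le i\le m$ (so $f_m=j_1$). **Column residual segments.** For a multipartition $\underline\lambda=(\lambda^{(1)},\dots,\lambda^{(m)})$ and $\underline u=(u_1,\dots,u_m)$,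 the $j$th column residual segment of $\lambda^{(i)}$ is $$\mathsf s^{(i)}_j=\big(u_iq^{2(j-(\lambda^{(i)\prime})_j)},\dots,u_iq^{2(j-2)},u_iq^{2(j-1)}\big)\quad(1\le i\le m,\ 1\le j\le\lambda^{(i)}_1),$$ and ${\bf s}^{\mathsf c}_{\underline\lambda;\underline u}=(\mathsf s^{(m)}_1,\dots,\mathsf s^{(m)}_{\lambda^{(m)}_1},\dots,\mathsf s^{(1)}_1,\dots,\mathsf s^{(1)}_{\lambda^{(1)}_1})$. *)

theory Defs
  imports Complex_Main "HOL-Library.Multiset" "HOL-Library.Product_Lexorder"
begin

definition segment :: "complex \<Rightarrow> int \<Rightarrow> int \<Rightarrow> complex list" where
  "segment q i j = map (\<lambda>k. q powi (2 * k)) [i..j]"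

definition integral_segment :: "complex \<Rightarrow> complex list \<Rightarrow> bool" where
  "integral_segment q s \<longleftrightarrow> (\<exists>i j. i \<le> j \<and> s = segment q i j)"

definition multisegments :: "complex \<Rightarrow> nat \<Rightarrow> complex list multiset set" where
  "multisegments q r =
    {S. (\<forall>s \<in># S. integral_segment q s) \<and> (\<Sum>s\<in>#S. length s) = r}"

text \<open>The exponents \<open>(i, j)\<close> of a segment are determined by the segment when \<open>q\<close> is not
  a root of unity; see \<open>endpoints_segment\<close> below.\<close>

definition endpoints :: "complex \<Rightarrow> complex list \<Rightarrow> int \<times> int" where
  "endpoints q s = (THE p. fst p \<le> snd p \<and> s = segment q (fst p) (snd p))"

definition standard_sequence :: "complex \<Rightarrow> complex list list \<Rightarrow> bool" where
  "standard_sequence q ss \<longleftrightarrow>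
    (\<forall>s \<in> set ss. integral_segment q s) \<and>
    (\<forall>k. Suc k < length ss \<longrightarrow>
      (let (i, j) = endpoints q (ss ! k); (i', j') = endpoints q (ss ! Suc k)
       in j \<le> j' \<and> (j = j' \<longrightarrow> i \<ge> i')))"

definition standard_element :: "complex \<Rightarrow> complex list multiset \<Rightarrow> complex list list" where
  "standard_element q S = (THE ss. mset ss = S \<and> standard_sequence q ss)"

text \<open>A partition is the list of its nonzero parts, so that its number of nonzero parts is
  the length of the list; \<open>part\<close> uses indices starting from 1 and extends by zero.\<close>

definition is_partition :: "nat list \<Rightarrow> bool" where
  "is_partition l \<longleftrightarrow> sorted_wrt (\<ge>) l \<and> 0 \<notin> set l"

definition part :: "nat list \<Rightarrow> nat \<Rightarrow> nat" where
  "part l b = (if 1 \<le> b \<and> b \<le> length l then l ! (b - 1) else 0)"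

definition conjugate :: "nat list \<Rightarrow> nat list" where
  "conjugate l = map (\<lambda>j. card {b \<in> {1..length l}. j \<le> part l b}) [1..<Suc (part l 1)]"

definition multipartition :: "nat \<Rightarrow> nat list list \<Rightarrow> bool" where
  "multipartition r L \<longleftrightarrow> (\<forall>l \<in> set L. is_partition l) \<and> sum_list (map sum_list L) = r"

definition sincere :: "nat list list \<Rightarrow> bool" where
  "sincere L \<longleftrightarrow> (\<forall>l \<in> set L. sum_list l > 0)"

definition mconjugate :: "nat list list \<Rightarrow> nat list list" where
  "mconjugate L = rev (map conjugate L)"

definition dom_seqs :: "nat \<Rightarrow> int list set" where
  "dom_seqs m = {f. length f = m \<and> sorted_wrt (\<ge>) f}"

definition all_dom_seqs :: "int list set" where
  "all_dom_seqs = (\<Union>m\<in>{1..}. dom_seqs m)"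

definition fstar :: "int list \<Rightarrow> int list" where
  "fstar f = rev (map uminus f)"

definition u_vec :: "complex \<Rightarrow> int list \<Rightarrow> complex list" where
  "u_vec q f = map (\<lambda>k. q powi (2 * k)) f"

text \<open>Components of \<open>f\<close> and \<open>G\<close> are indexed from 0, parts of a component from 1. The
  definition is meant for weakly decreasing \<open>f\<close>, so that the arguments of \<open>nat\<close> are
  nonnegative.\<close>

definition standard_multipartitions :: "int list \<Rightarrow> nat \<Rightarrow> nat list list set" where
  "standard_multipartitions f r =
    {G. multipartition r G \<and> length G = length f \<and>
      (\<forall>a < length f. length (G ! a) \<ge> 1) \<and>
      (\<forall>a. Suc a < length f \<longrightarrow>
        (let d = f ! a - f ! Suc a in
          int (length (G ! a)) \<le> d + 1 \<and>
          part (G ! a) (nat (d + 1)) \<le> part (G ! Suc a) 1)) \<and>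
      (\<forall>a. Suc a < length f \<longrightarrow>
        (let d = f ! a - f ! Suc a in
          int (length (G ! a)) = d \<longrightarrow>
          int (part (G ! a) (nat d)) \<le> int (part (G ! Suc a) 1) - 1))}"

text \<open>Meant for nonempty \<open>ps\<close>, whose entries are pairs of exponents \<open>(i, j)\<close>.\<close>

definition block_length :: "(int \<times> int) list \<Rightarrow> nat" where
  "block_length ps = Max {k \<in> {1..length ps}. \<forall>a. Suc a < k \<longrightarrow>
     snd (ps ! Suc a) = snd (ps ! a) + 1 \<and> fst (ps ! a) < fst (ps ! Suc a)}"

lemma block_length_bounds:
  assumes "ps \<noteq> []"
  shows "1 \<le> block_length ps" "block_length ps \<le> length ps"
proof -
  let ?K = "{k \<in> {1..length ps}. \<forall>a. Suc a < k \<longrightarrow>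
     snd (ps ! Suc a) = snd (ps ! a) + 1 \<and> fst (ps ! a) < fst (ps ! Suc a)}"
  have "1 \<in> ?K" using assms by (cases ps) simp_all
  then have "?K \<noteq> {}" by blast
  moreover have "finite ?K" by simp
  ultimately have "block_length ps \<in> ?K"
    unfolding block_length_def by (intro Max_in)
  then show "1 \<le> block_length ps" "block_length ps \<le> length ps"
    by simp_all
qed

function blocks :: "(int \<times> int) list \<Rightarrow> (int \<times> int) list list" where
  "blocks ps = (if ps = [] then []
     else take (block_length ps) ps # blocks (drop (block_length ps) ps))"
  by pat_completeness auto
termination
proof (relation "measure length")
  show "(drop (block_length ps) ps, ps) \<in> measure length" if "ps \<noteq> []" for ps
    using block_length_bounds(1)[OF that] that by auto
qed simp

declare blocks.simps [simp del]

definition seg_blocks :: "complex \<Rightarrow> complex list multiset \<Rightarrow> (int \<times> int) list list" where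
  "seg_blocks q S = blocks (map (endpoints q) (standard_element q S))"

definition gamma_of :: "complex \<Rightarrow> complex list multiset \<Rightarrow> nat list list" where
  "gamma_of q S = map (map (\<lambda>(i, j). nat (j - i + 1))) (seg_blocks q S)"

text \<open>Entry \<open>i\<close> of \<open>f\<close> is the final exponent of the first segment of block \<open>m - i + 1\<close>.\<close>

definition f_of :: "complex \<Rightarrow> complex list multiset \<Rightarrow> int list" where
  "f_of q S = rev (map (\<lambda>b. snd (hd b)) (seg_blocks q S))"

definition u_of :: "complex \<Rightarrow> complex list multiset \<Rightarrow> complex list" where
  "u_of q S = u_vec q (f_of q S)"

definition multisegments_with :: "complex \<Rightarrow> nat \<Rightarrow> int list \<Rightarrow> complex list multiset set" where
  "multisegments_with q r f = {S \<in> multisegments q r. u_of q S = u_vec q f}"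

definition column_segment :: "complex \<Rightarrow> complex \<Rightarrow> nat list \<Rightarrow> nat \<Rightarrow> complex list" where
  "column_segment q u l j =
    map (\<lambda>k. u * q powi (2 * k)) [int j - int (part (conjugate l) j)..int j - 1]"

text \<open>The components are traversed from the last to the first, the columns of each
  component from left to right.\<close>

definition column_segments :: "complex \<Rightarrow> nat list list \<Rightarrow> complex list \<Rightarrow> complex list list" where
  "column_segments q L us =
    concat (rev (map2 (\<lambda>l u. map (column_segment q u l) [1..<Suc (part l 1)]) L us))"

lemma powi_double_eq_iff:
  fixes q :: complex
  assumes "q \<noteq> 0" and "\<forall>n>0. q ^ n \<noteq> 1"
  shows "q powi (2 * i) = q powi (2 * j) \<longleftrightarrow> i = j"
proof
  have aux: "q powi (2 * a) \<noteq> q powi (2 * b)" if "a < b" for a b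
  proof
    assume "q powi (2 * a) = q powi (2 * b)"
    then have "q powi (2 * b - 2 * a) = 1"
      using assms(1) by (simp add: power_int_diff)
    moreover have "2 * b - 2 * a = int (nat (2 * b - 2 * a))" using that by simp
    ultimately have "q ^ nat (2 * b - 2 * a) = 1" by (metis power_int_of_nat)
    moreover have "nat (2 * b - 2 * a) > 0" using that by simp
    ultimately show False using assms(2) by blast
  qed
  show "i = j" if "q powi (2 * i) = q powi (2 * j)"
    using aux[of i j] aux[of j i] that by (cases i j rule: linorder_cases) auto
qed simp

lemma endpoints_segment:
  assumes "q \<noteq> 0" and "\<forall>n>0. q ^ n \<noteq> 1" and "i \<le> j"
  shows "endpoints q (segment q i j) = (i, j)"
proof -
  have "p = (i, j)"
    if "fst p \<le> snd p" "segment q i j = segment q (fst p) (snd p)" for p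
  proof -
    have hl: "hd (segment q a b) = q powi (2 * a)" "last (segment q a b) = q powi (2 * b)"
      if "a \<le> b" for a b :: int
    proof -
      show "hd (segment q a b) = q powi (2 * a)"
        by (simp add: segment_def upto_rec1[OF that])
      show "last (segment q a b) = q powi (2 * b)"
        by (simp add: segment_def upto_rec2[OF that])
    qed
    show ?thesis
      using hl[OF assms(3)] hl[OF that(1)] that(2)
        powi_double_eq_iff[OF assms(1,2), of i "fst p"] powi_double_eq_iff[OF assms(1,2), of j "snd p"]
      by (simp add: prod_eq_iff)
  qed
  then show ?thesis unfolding endpoints_def
    using assms(3) by (intro the_equality) auto
qed

lemma standard_sequence_iff:
  "standard_sequence q ss \<longleftrightarrow> (\<forall>s \<in> set ss. integral_segment q s) \<and>
    sorted (map (\<lambda>s. (snd (endpoints q s), - fst (endpoints q s))) ss)"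
proof -
  have "(let (i, j) = p; (i', j') = p' in j \<le> j' \<and> (j = j' \<longrightarrow> i \<ge> i'))
      \<longleftrightarrow> (snd p, - fst p) \<le> (snd p', - fst p')" for p p' :: "int \<times> int"
    by (cases p; cases p') auto
  then show ?thesis
    unfolding standard_sequence_def sorted_iff_nth_Suc by simp
qed

lemma standard_element_ex1:
  assumes "q \<noteq> 0" and "\<forall>n>0. q ^ n \<noteq> 1" and "\<forall>s \<in># S. integral_segment q s"
  shows "\<exists>!ss. mset ss = S \<and> standard_sequence q ss"
proof -
  let ?k = "\<lambda>s. (snd (endpoints q s), - fst (endpoints q s))"
  obtain xs where xs: "mset xs = S" using ex_mset by blast
  have inj: "inj_on ?k (set_mset S)"
  proof (rule inj_onI)
    fix s t assume st: "s \<in># S" "t \<in># S" "?k s = ?k t"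
    obtain i j where s: "i \<le> j" "s = segment q i j"
      using assms(3) st(1) unfolding integral_segment_def by blast
    obtain i' j' where t: "i' \<le> j'" "t = segment q i' j'"
      using assms(3) st(2) unfolding integral_segment_def by blast
    show "s = t"
      using st(3) s t endpoints_segment[OF assms(1,2)] by simp
  qed
  show ?thesis
  proof (rule ex1I)
    have set: "set xs = set_mset S" using xs by auto
    show "mset (sort_key ?k xs) = S \<and> standard_sequence q (sort_key ?k xs)"
      using xs assms(3) set by (simp add: standard_sequence_iff)
  next
    fix ss assume ss: "mset ss = S \<and> standard_sequence q ss"
    have "sort_key ?k xs = ss"
    proof (rule properties_for_sort_key)
      show "mset ss = mset xs" using ss xs by simp
      show "sorted (map ?k ss)" using ss by (simp add: standard_sequence_iff)
      fix k assume k: "k \<in> set ss"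
      have setss: "set ss = set_mset S" "set xs = set_mset S"
        using ss xs by (metis set_mset_mset)+
      have "filter (\<lambda>x. ?k k = ?k x) zs = replicate (count (mset zs) k) k"
        if zs: "set zs = set_mset S" for zs
      proof -
        have "?k k = ?k x \<longleftrightarrow> k = x" if "x \<in> set zs" for x
          by (rule inj_on_eq_iff[OF inj]) (use k setss zs that in auto)
        then have "filter (\<lambda>x. ?k k = ?k x) zs = filter (\<lambda>x. k = x) zs"
          by (rule filter_cong[OF refl])
        also have "\<dots> = replicate (count (mset zs) k) k"
          by (induction zs) auto
        finally show ?thesis .
      qed
      from this[OF setss(1)] this[OF setss(2)]
      show "filter (\<lambda>x. ?k k = ?k x) ss = filter (\<lambda>x. ?k k = ?k x) xs"
        using ss xs by (simp only:)
    qed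
    then show "ss = sort_key ?k xs" by simp
  qed
qed

end

theory Submission
  imports Defs
begin

text \<open>
  Since \<open>q\<close> is not a root of unity, a segment is the same thing as its pair of exponents
  \<open>(i, j)\<close>, and a multisegment is the same thing as its standard ordering, a sequence of
  such pairs. So everything happens on sequences of pairs of integers.

  A block of the standard ordering has final exponents \<open>J, J + 1, J + 2, \<dots>\<close> and strictly
  increasing initial exponents. Because the final exponents grow by exactly one, the initial
  ones grow by at least one if and only if the lengths weakly decrease. Hence a block carries
  precisely the data of \<open>J\<close> and a partition, and is recovered from them as the sequence
  \<open>stair J l\<close> (lemma \<open>linked_eq_stair\<close>). Call \<open>J\<close> the starting
  exponent of the block, although it is the final exponent of its first segment. The whole sequence
  is then given by a list \<open>Js\<close> of starting exponents and a list \<open>G\<close> of nonempty partitions.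

  Conversely, such data come from a multisegment exactly when two things hold at each border
  between neighbouring blocks: the last pair of the one block may stand before the first pair
  of the next in the standard ordering, and these two pairs do not prolong the block. Writing
  this out (lemma \<open>junction_iff\<close>) gives conditions (SK2) and (SK3) for \<open>d = J' - J\<close>: (SK2)
  is the ordering condition, with equal final exponents when the length is \<open>d + 1\<close>, and
  (SK3) is maximality of the block, which is in question only when the length is \<open>d\<close>. As the
  starting exponents are \<open>f\<close> read backwards, these differences are those of \<open>f\<^sup>*\<close>. So
  multisegments correspond to the pairs \<open>(Js, G)\<close> satisfying \<open>chain\<close>
  (lemmas \<open>multisegment_eq_chain\<close> and \<open>gamma_of_chain\<close>), and fixing \<open>f\<close> fixes \<open>Js\<close>, which is
  the bijection.

  The columns of the conjugate of a partition are its parts, because conjugation is an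
  involution; so the column residual segments run through each stair in order
  (lemma \<open>column_segments_chain\<close>).
\<close>

section \<open>Conjugating partitions\<close>

lemma part_antimono:
  assumes "is_partition l" "1 \<le> a" "a \<le> b"
  shows "part l b \<le> part l a"
proof (cases "a < b \<and> b \<le> length l")
  case True
  then have "a - 1 < b - 1" "b - 1 < length l" using assms(2) by auto
  then have "l ! (b - 1) \<le> l ! (a - 1)"
    using assms(1) unfolding is_partition_def sorted_wrt_iff_nth_less by blast
  then show ?thesis using True assms(2) by (simp add: part_def)
next
  case False
  then show ?thesis using assms(3) by (auto simp: part_def)
qed

lemma part_pos_iff:
  assumes "is_partition l" "1 \<le> b"
  shows "1 \<le> part l b \<longleftrightarrow> b \<le> length l"
proof -
  have "l ! (b - 1) \<noteq> 0" if "b \<le> length l"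
    using assms that unfolding is_partition_def
    by (metis diff_less less_one nth_mem order_less_le_trans zero_less_one)
  then show ?thesis using assms(2) by (auto simp: part_def Suc_le_eq)
qed

text \<open>A set of positive integers closed downwards among them is an initial segment, so its size
  tells which numbers it contains. This turns the counting definition of the conjugate into the
  symmetric relation of \<open>le_part_conjugate_iff\<close>.\<close>

lemma card_downset_iff:
  fixes A :: "nat set"
  assumes fin: "finite A" and down: "\<And>a b. b \<in> A \<Longrightarrow> 1 \<le> a \<Longrightarrow> a \<le> b \<Longrightarrow> a \<in> A"
    and "0 \<notin> A" "1 \<le> b"
  shows "b \<le> card A \<longleftrightarrow> b \<in> A"
proof
  show "b \<le> card A" if "b \<in> A"
  proof -
    have "{1..b} \<subseteq> A" using down[OF that] by auto
    from card_mono[OF fin this] show ?thesis by simp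
  qed
  show "b \<in> A" if "b \<le> card A"
  proof (rule ccontr)
    assume "b \<notin> A"
    then have "A \<subseteq> {1..<b}"
      using down[of _ b] assms(3,4) by (force simp: not_less Suc_le_eq intro: gr0I)
    then have "card A \<le> b - 1" using card_mono[of "{1..<b}" A] by simp
    with that assms(4) show False by simp
  qed
qed

text \<open>The list defining the conjugate stops at the first part of \<open>l\<close>; beyond it the count is
  zero, in agreement with the zero extension of \<open>part\<close>.\<close>

lemma part_conjugate:
  assumes "is_partition l" "1 \<le> j"
  shows "part (conjugate l) j = card {b \<in> {1..length l}. j \<le> part l b}"
proof (cases "j \<le> part l 1")
  case True
  then have "j - 1 < part l 1" "[1..<Suc (part l 1)] ! (j - 1) = j" using assms(2)
    by (auto simp: nth_append simp del: upt_Suc)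
  then show ?thesis using True assms(2) unfolding part_def[of "conjugate l"]
    by (simp add: conjugate_def del: upt_Suc)
next
  case False
  have "{b \<in> {1..length l}. j \<le> part l b} = {}"
    using False part_antimono[OF assms(1), of 1] by (auto dest: order_trans)
  then show ?thesis using False unfolding part_def[of "conjugate l"]
    by (simp add: conjugate_def del: upt_Suc)
qed

text \<open>Both sides say that the box in row \<open>b\<close> and column \<open>j\<close> belongs to the Young diagram. The
  symmetry in \<open>b\<close> and \<open>j\<close> makes conjugation an involution.\<close>

lemma le_part_conjugate_iff:
  assumes "is_partition l" "1 \<le> j" "1 \<le> b"
  shows "b \<le> part (conjugate l) j \<longleftrightarrow> j \<le> part l b"
proof -
  let ?A = "{b \<in> {1..length l}. j \<le> part l b}"
  have "b \<le> card ?A \<longleftrightarrow> b \<in> ?A"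
    by (rule card_downset_iff) (use assms part_antimono[OF assms(1)] in \<open>auto intro: order_trans\<close>)
  also have "\<dots> \<longleftrightarrow> j \<le> part l b"
    using assms by (auto simp: part_def)
  finally show ?thesis by (simp only: part_conjugate[OF assms(1,2)])
qed

lemma is_partition_conjugate:
  assumes "is_partition l"
  shows "is_partition (conjugate l)"
proof -
  have "card {b \<in> {1..length l}. k \<le> part l b} \<le> card {b \<in> {1..length l}. j \<le> part l b}"
    if "j \<le> k" for j k
    by (rule card_mono) (use that in auto)
  then have "sorted_wrt (\<ge>) (conjugate l)"
    unfolding conjugate_def sorted_wrt_map
    by (intro sorted_wrt_mono_rel[OF _ sorted_wrt_upt]) auto
  moreover have "part (conjugate l) j \<noteq> 0" if "1 \<le> j" "j \<le> part l 1" for j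
    using le_part_conjugate_iff[OF assms, of j 1] that by simp
  then have "card {b \<in> {1..length l}. j \<le> part l b} \<noteq> 0" if "j \<in> {1..<Suc (part l 1)}" for j
    using that part_conjugate[OF assms, of j] by (metis atLeastLessThan_iff less_Suc_eq_le)
  then have "0 \<notin> set (conjugate l)"
    unfolding conjugate_def set_map set_upt image_iff by metis
  ultimately show ?thesis by (simp add: is_partition_def)
qed

lemma part_conjugate_conjugate:
  assumes "is_partition l" "1 \<le> b"
  shows "part (conjugate (conjugate l)) b = part l b"
proof -
  have "j \<le> part (conjugate (conjugate l)) b \<longleftrightarrow> j \<le> part l b" if "1 \<le> j" for j
    using assms that by (simp add: le_part_conjugate_iff is_partition_conjugate)
  then show ?thesis
    by (metis (no_types, lifting) le_antisym le_zero_eq nat_le_linear not_less_eq_eq One_nat_def)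
qed

lemma part_conjugate_1:
  assumes "is_partition l"
  shows "part (conjugate l) 1 = length l"
proof -
  have "{b \<in> {1..length l}. 1 \<le> part l b} = {1..length l}"
    using part_pos_iff[OF assms] by auto
  then show ?thesis using part_conjugate[OF assms, of 1] by simp
qed

section \<open>Staircases of exponent pairs\<close>

text \<open>The relation between neighbouring pairs that keeps them in the same block.\<close>

definition link :: "int \<times> int \<Rightarrow> int \<times> int \<Rightarrow> bool" where
  "link p p' \<longleftrightarrow> snd p' = snd p + 1 \<and> fst p < fst p'"

text \<open>The relation between neighbours in a standard sequence.\<close>

definition seg_le :: "int \<times> int \<Rightarrow> int \<times> int \<Rightarrow> bool" where
  "seg_le p p' \<longleftrightarrow> snd p \<le> snd p' \<and> (snd p = snd p' \<longrightarrow> fst p' \<le> fst p)"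

definition seg_length :: "int \<times> int \<Rightarrow> nat" where
  "seg_length p = nat (snd p - fst p + 1)"

fun stair :: "int \<Rightarrow> nat list \<Rightarrow> (int \<times> int) list" where
  "stair J [] = []"
| "stair J (n # l) = (J - int n + 1, J) # stair (J + 1) l"

lemma length_stair [simp]: "length (stair J l) = length l"
  by (induction l arbitrary: J) auto

lemma stair_eq_Nil_iff [simp]: "stair J l = [] \<longleftrightarrow> l = []"
  by (cases l) auto

lemma nth_stair: "b < length l \<Longrightarrow> stair J l ! b = (J + int b - int (l ! b) + 1, J + int b)"
  by (induction l arbitrary: J b) (auto simp: nth_Cons' of_nat_diff)

lemma map_seg_length_stair [simp]: "map seg_length (stair J l) = l"
  by (induction l arbitrary: J) (auto simp: seg_length_def)

lemma hd_stair: "l \<noteq> [] \<Longrightarrow> hd (stair J l) = (J - int (hd l) + 1, J)"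
  by (cases l) auto

lemma last_stair:
  "l \<noteq> [] \<Longrightarrow> last (stair J l) = (J + int (length l) - int (last l), J + int (length l) - 1)"
proof (cases "length l")
  case (Suc n)
  moreover from this have "l \<noteq> []" "stair J l \<noteq> []" by auto
  ultimately show ?thesis by (simp add: last_conv_nth nth_stair)
qed simp

lemma stair_nondegenerate: "0 \<notin> set l \<Longrightarrow> p \<in> set (stair J l) \<Longrightarrow> fst p \<le> snd p"
  by (induction l arbitrary: J) auto

lemma is_partition_Cons_iff:
  "is_partition (n # l) \<longleftrightarrow> n \<noteq> 0 \<and> (l \<noteq> [] \<longrightarrow> hd l \<le> n) \<and> is_partition l"
proof -
  have "sorted_wrt (\<ge>) (n # l) \<longleftrightarrow> (l \<noteq> [] \<longrightarrow> hd l \<le> n) \<and> sorted_wrt (\<ge>) l"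
    by (cases l) auto
  then show ?thesis by (auto simp: is_partition_def)
qed

lemma successively_link_stair: "is_partition l \<Longrightarrow> successively link (stair J l)"
proof (induction l arbitrary: J)
  case (Cons n l)
  then show ?case
    using Cons.IH[of "J + 1"] by (cases l) (auto simp: is_partition_Cons_iff link_def)
qed auto

text \<open>Along a link the final exponent grows by one and the initial exponent by at least one, so
  the length cannot grow: the lengths of a block form a partition. Together with the first final
  exponent they determine every pair.\<close>

lemma linked_eq_stair:
  assumes "successively link b" "\<forall>p \<in> set b. fst p \<le> snd p" "b \<noteq> []"
  shows "b = stair (snd (hd b)) (map seg_length b) \<and> is_partition (map seg_length b)"
  using assms
proof (induction b)
  case (Cons p b)
  show ?case
  proof (cases b)
    case Nil
    then show ?thesis using Cons.prems
      by (cases p) (auto simp: is_partition_def seg_length_def)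
  next
    case (Cons p' b')
    then show ?thesis using Cons.prems Cons.IH
      by (cases p) (auto simp: is_partition_Cons_iff seg_length_def link_def)
  qed
qed simp

section \<open>Decomposition into blocks\<close>

text \<open>A condition on neighbours in a concatenation splits into conditions inside the blocks and
  conditions at the borders, so the standard ordering and the maximality of blocks can both be
  checked border by border.\<close>

lemma successively_concat:
  assumes "[] \<notin> set bs"
  shows "successively R (concat bs) \<longleftrightarrow>
    (\<forall>b \<in> set bs. successively R b) \<and> successively (\<lambda>b c. R (last b) (hd c)) bs"
  using assms
proof (induction bs)
  case (Cons b bs)
  then show ?case
    by (cases bs) (auto simp: successively_append_iff)
qed simp

text \<open>A linked list is cut off exactly at its end when the next pair does not continue it.\<close>

lemma block_length_append:
  assumes "successively link b" "b \<noteq> []" "ps = [] \<or> \<not> link (last b) (hd ps)"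
  shows "block_length (b @ ps) = length b"
proof -
  have eq: "block_length (b @ ps) = Max {k \<in> {1..length (b @ ps)}.
      \<forall>a. Suc a < k \<longrightarrow> link ((b @ ps) ! a) ((b @ ps) ! Suc a)}"
    unfolding block_length_def link_def by simp
  show ?thesis unfolding eq
  proof (rule Max_eqI)
    show "length b \<in> {k \<in> {1..length (b @ ps)}.
        \<forall>a. Suc a < k \<longrightarrow> link ((b @ ps) ! a) ((b @ ps) ! Suc a)}"
      using assms(1,2) by (auto simp: successively_conv_nth nth_append Suc_le_eq)
  next
    fix k assume k: "k \<in> {k \<in> {1..length (b @ ps)}.
        \<forall>a. Suc a < k \<longrightarrow> link ((b @ ps) ! a) ((b @ ps) ! Suc a)}"
    show "k \<le> length b"
    proof (rule ccontr)
      assume gt: "\<not> k \<le> length b"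
      then have "Suc (length b - 1) < k" using assms(2) by simp
      with k have "link ((b @ ps) ! (length b - 1)) ((b @ ps) ! Suc (length b - 1))" by blast
      moreover have "ps \<noteq> []" using gt k by auto
      ultimately show False using assms(2,3)
        by (simp add: nth_append last_conv_nth hd_conv_nth)
    qed
  qed simp
qed

text \<open>A decomposition into nonempty linked blocks with no link across a border is the greedy
  one. It therefore suffices to exhibit such a decomposition in order to know \<open>blocks\<close>.\<close>

lemma blocks_concat:
  assumes "[] \<notin> set bs" "\<forall>b \<in> set bs. successively link b"
    "successively (\<lambda>b c. \<not> link (last b) (hd c)) bs"
  shows "blocks (concat bs) = bs"
  using assms
proof (induction bs)
  case Nil
  then show ?case by (simp add: blocks.simps)
next
  case (Cons b bs)
  have "concat bs = [] \<or> \<not> link (last b) (hd (concat bs))"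
    using Cons.prems by (cases bs) auto
  then have "block_length (b @ concat bs) = length b"
    using Cons.prems by (intro block_length_append) auto
  moreover have "blocks (concat bs) = bs"
    using Cons.prems by (intro Cons.IH) (auto simp: successively_Cons)
  ultimately show ?case
    using Cons.prems by (subst blocks.simps) auto
qed

lemma block_decomposition_exists:
  "\<exists>bs. concat bs = ps \<and> [] \<notin> set bs \<and> (\<forall>b \<in> set bs. successively link b) \<and>
    successively (\<lambda>b c. \<not> link (last b) (hd c)) bs"
proof (induction ps)
  case Nil
  show ?case by (intro exI[of _ "[]"]) auto
next
  case (Cons p ps)
  then obtain bs where bs: "concat bs = ps" "[] \<notin> set bs" "\<forall>b \<in> set bs. successively link b"
    "successively (\<lambda>b c. \<not> link (last b) (hd c)) bs" by blast
  show ?case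
  proof (cases bs)
    case Nil
    then show ?thesis using bs by (intro exI[of _ "[[p]]"]) auto
  next
    case (Cons b bs')
    show ?thesis
    proof (cases "link p (hd b)")
      case True
      then show ?thesis using bs Cons
        by (intro exI[of _ "(p # b) # bs'"]) (auto simp: successively_Cons)
    next
      case False
      then show ?thesis using bs Cons
        by (intro exI[of _ "[p] # bs"]) (auto simp: successively_Cons)
    qed
  qed
qed

section \<open>Chains of staircases\<close>

text \<open>The border condition for two blocks given by starting exponent and partition: the standard
  ordering continues across it, and the first block ends there.\<close>

definition junction :: "int \<times> nat list \<Rightarrow> int \<times> nat list \<Rightarrow> bool" where
  "junction x y \<longleftrightarrow> (let b = stair (fst x) (snd x); c = stair (fst y) (snd y) in
     seg_le (last b) (hd c) \<and> \<not> link (last b) (hd c))"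

text \<open>The data from which multisegments are built: \<open>Js\<close> lists the final exponents of the first
  segments of the blocks in weakly increasing order, hence is \<open>f\<close> backwards.\<close>

definition chain :: "int list \<Rightarrow> nat list list \<Rightarrow> bool" where
  "chain Js G \<longleftrightarrow> length Js = length G \<and> [] \<notin> set G \<and> (\<forall>l \<in> set G. is_partition l) \<and>
     successively junction (zip Js G)"

definition stairs :: "int list \<Rightarrow> nat list list \<Rightarrow> (int \<times> int) list list" where
  "stairs Js G = map2 stair Js G"

text \<open>With \<open>d = J' - J\<close>, the first block ends at final exponent \<open>J + length l - 1\<close>. It stays
  at most \<open>J'\<close> iff \<open>length l \<le> d + 1\<close>. For \<open>length l = d + 1\<close> the final exponents agree, and the
  ordering compares the lengths of the two segments. For \<open>length l = d\<close> the final exponents are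
  consecutive, and the absence of a link says that the first segment is shorter than the second.
  For \<open>length l < d\<close> the final exponents jump by more than one, which is in order and no link, and
  the part with index \<open>d + 1\<close> is zero.\<close>

lemma junction_iff:
  assumes "l \<noteq> []" "l' \<noteq> []" 
  shows "junction (J, l) (J', l') \<longleftrightarrow>
    int (length l) \<le> J' - J + 1 \<and> part l (nat (J' - J + 1)) \<le> part l' 1 \<and>
    (int (length l) = J' - J \<longrightarrow> int (part l (nat (J' - J))) \<le> int (part l' 1) - 1)"
proof -
  have first: "part l' 1 = hd l'" using assms(2) by (cases l') (auto simp: part_def)
  have at_end: "part l (nat d) = last l" if "int (length l) = d" for d
    using assms(1) that by (auto simp: part_def last_conv_nth Suc_le_eq)
  have beyond: "part l (nat d) = 0" if "int (length l) < d" for d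
    using that by (auto simp: part_def)
  show ?thesis
    unfolding junction_def using assms first at_end[of "J' - J"] at_end[of "J' - J + 1"]
      beyond[of "J' - J + 1"]
    by (cases "int (length l) < J' - J + 1")
      (auto simp: Let_def hd_stair last_stair seg_le_def link_def)
qed

lemma standard_multipartitions_iff_chain:
  "G \<in> standard_multipartitions (map uminus Js) r \<longleftrightarrow> chain Js G \<and> sum_list (map sum_list G) = r"
proof -
  have *: "junction (Js ! a, G ! a) (Js ! Suc a, G ! Suc a) \<longleftrightarrow>
     (let d = map uminus Js ! a - map uminus Js ! Suc a in
          int (length (G ! a)) \<le> d + 1 \<and>
          part (G ! a) (nat (d + 1)) \<le> part (G ! Suc a) 1) \<and>
     (let d = map uminus Js ! a - map uminus Js ! Suc a in
          int (length (G ! a)) = d \<longrightarrow>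
          int (part (G ! a) (nat d)) \<le> int (part (G ! Suc a) 1) - 1)"
    if "length Js = length G" "[] \<notin> set G" "Suc a < length G" for a
  proof -
    have "G ! a \<noteq> []" "G ! Suc a \<noteq> []" using that by (metis nth_mem Suc_lessD)+
    then show ?thesis using that by (simp add: junction_iff Let_def)
  qed
  have ne: "(\<forall>a < length G. length (G ! a) \<ge> 1) \<longleftrightarrow> [] \<notin> set G"
    by (auto simp: in_set_conv_nth Suc_le_eq)
  show ?thesis
    unfolding standard_multipartitions_def chain_def multipartition_def mem_Collect_eq
      successively_conv_nth length_map
    using ne * by (auto simp del: One_nat_def)
qed

text \<open>A block is nonempty, so its last final exponent is at least its first, and it is at most
  the first final exponent of the next block.\<close>

lemma chain_imp_sorted:
  assumes "chain Js G"
  shows "sorted Js"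
  unfolding sorted_iff_nth_Suc
proof (intro allI impI)
  fix a assume a: "Suc a < length Js"
  with assms have ne: "G ! a \<noteq> []" "G ! Suc a \<noteq> []"
    unfolding chain_def by (metis nth_mem Suc_lessD)+
  have "junction (Js ! a, G ! a) (Js ! Suc a, G ! Suc a)"
    using assms a by (auto simp: chain_def successively_conv_nth)
  then have "int (length (G ! a)) \<le> Js ! Suc a - Js ! a + 1"
    unfolding junction_iff[OF ne] by blast
  moreover have "0 < length (G ! a)" using ne(1) by simp
  ultimately show "Js ! a \<le> Js ! Suc a" by linarith
qed

lemma seg_le_if_link: "link p p' \<Longrightarrow> seg_le p p'"
  by (simp add: link_def seg_le_def)

lemma chain_stairs:
  assumes "chain Js G"
  shows "[] \<notin> set (stairs Js G)" "\<forall>b \<in> set (stairs Js G). successively link b"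
    "successively (\<lambda>b c. seg_le (last b) (hd c) \<and> \<not> link (last b) (hd c)) (stairs Js G)"
proof -
  have "stair J l \<noteq> [] \<and> successively link (stair J l)" if "(J, l) \<in> set (zip Js G)" for J l
    using set_zip_rightD[OF that] assms by (auto simp: chain_def intro: successively_link_stair)
  then have "b \<noteq> [] \<and> successively link b" if "b \<in> set (stairs Js G)" for b
    using that unfolding stairs_def by force
  then show "[] \<notin> set (stairs Js G)" and "\<forall>b \<in> set (stairs Js G). successively link b"
    by blast+
  show "successively (\<lambda>b c. seg_le (last b) (hd c) \<and> \<not> link (last b) (hd c)) (stairs Js G)"
    using assms
    by (simp add: chain_def stairs_def successively_map junction_def Let_def split_beta)
qed

lemma blocks_stairs: "chain Js G \<Longrightarrow> blocks (concat (stairs Js G)) = stairs Js G"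
  using chain_stairs[of Js G]
  by (intro blocks_concat) (auto elim: successively_mono)

lemma successively_seg_le_stairs:
  assumes "chain Js G"
  shows "successively seg_le (concat (stairs Js G))"
  using chain_stairs[OF assms]
  by (subst successively_concat)
    (auto elim: successively_mono intro: seg_le_if_link successively_mono[of link])

lemma stairs_nondegenerate:
  assumes "chain Js G" "p \<in> set (concat (stairs Js G))"
  shows "fst p \<le> snd p"
  using assms
  by (auto simp: chain_def stairs_def is_partition_def
      dest!: set_zip_rightD intro!: stair_nondegenerate)

lemma map_seg_length_stairs:
  assumes "length Js = length G"
  shows "map (map seg_length) (stairs Js G) = G"
  using assms unfolding stairs_def by (induction Js G rule: list_induct2) auto

lemma map_hd_stairs:
  assumes "length Js = length G" "[] \<notin> set G"
  shows "map (\<lambda>b. snd (hd b)) (stairs Js G) = Js"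
  using assms unfolding stairs_def by (induction Js G rule: list_induct2) (auto simp: hd_stair)

text \<open>Cut the sequence into its blocks; each block is a stair, and the ordering and the
  maximality of the blocks give the border conditions.\<close>

lemma chain_exists:
  assumes sorted: "successively seg_le ps" and pos: "\<forall>p \<in> set ps. fst p \<le> snd p"
  shows "\<exists>Js G. chain Js G \<and> ps = concat (stairs Js G)"
proof -
  obtain bs where bs: "concat bs = ps" "[] \<notin> set bs" "\<forall>b \<in> set bs. successively link b"
    "successively (\<lambda>b c. \<not> link (last b) (hd c)) bs"
    using block_decomposition_exists by blast
  define Js where "Js = map (\<lambda>b. snd (hd b)) bs"
  define G where "G = map (map seg_length) bs"
  have stair: "stair (snd (hd b)) (map seg_length b) = b" "is_partition (map seg_length b)"
    if "b \<in> set bs" for b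
    using linked_eq_stair[of b] that bs pos by fastforce+
  have stairs: "stairs Js G = bs"
    unfolding stairs_def Js_def G_def zip_map_map
    by (simp add: zip_same_conv_map stair(1) cong: map_cong)
  have "successively seg_le (concat bs)" using sorted bs(1) by simp
  then have "successively (\<lambda>b c. seg_le (last b) (hd c)) bs"
    by (simp add: successively_concat[OF bs(2)])
  with bs(4) have "successively (\<lambda>b c. seg_le (last b) (hd c) \<and> \<not> link (last b) (hd c)) bs"
    by (simp add: successively_conv_nth)
  then have "successively junction (zip Js G)"
    unfolding stairs[symmetric] stairs_def successively_map
    by (simp add: junction_def Let_def split_beta)
  then have "chain Js G"
    using bs(2) stair(2) by (auto simp: chain_def Js_def G_def)
  with stairs bs(1) show ?thesis by blast
qed

section \<open>Multisegments as chains\<close>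

definition chain_segments :: "complex \<Rightarrow> int list \<Rightarrow> nat list list \<Rightarrow> complex list list" where
  "chain_segments q Js G = map (\<lambda>p. segment q (fst p) (snd p)) (concat (stairs Js G))"

lemma standard_sequence_iff_successively:
  "standard_sequence q ss \<longleftrightarrow>
    (\<forall>s \<in> set ss. integral_segment q s) \<and> successively seg_le (map (endpoints q) ss)"
  unfolding standard_sequence_def successively_conv_nth seg_le_def
  by (auto simp: Let_def split_beta)

lemma length_segment: "fst p \<le> snd p \<Longrightarrow> length (segment q (fst p) (snd p)) = seg_length p"
  by (simp add: segment_def seg_length_def)

lemma sum_list_map_seg_length_concat:
  "sum_list (map seg_length (concat bs)) = sum_list (map sum_list (map (map seg_length) bs))"
  by (induction bs) auto

context
  fixes q :: complex
  assumes q_nonzero: "q \<noteq> 0" and q_not_root: "\<forall>n>0. q ^ n \<noteq> 1"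
begin

lemma u_vec_eq_iff: "u_vec q f = u_vec q f' \<longleftrightarrow> f = f'"
proof -
  have "inj (\<lambda>k. q powi (2 * k))"
    using powi_double_eq_iff[OF q_nonzero q_not_root] by (auto intro: injI)
  then show ?thesis unfolding u_vec_def by (simp add: inj_map_eq_map)
qed

lemma standard_element_unique:
  assumes "standard_sequence q ss"
  shows "standard_element q (mset ss) = ss"
  unfolding standard_element_def
proof (rule the1_equality)
  show "\<exists>!ts. mset ts = mset ss \<and> standard_sequence q ts"
    using assms by (intro standard_element_ex1 q_nonzero q_not_root)
      (auto simp: standard_sequence_def)
qed (use assms in simp)

lemma endpoints_chain_segments:
  assumes "chain Js G"
  shows "map (endpoints q) (chain_segments q Js G) = concat (stairs Js G)"
  unfolding chain_segments_def map_map
  by (rule map_idI) 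
    (use stairs_nondegenerate[OF assms] endpoints_segment[OF q_nonzero q_not_root] in auto)

lemma standard_sequence_chain_segments:
  assumes "chain Js G"
  shows "standard_sequence q (chain_segments q Js G)"
  unfolding standard_sequence_iff_successively endpoints_chain_segments[OF assms]
  using stairs_nondegenerate[OF assms] successively_seg_le_stairs[OF assms]
  by (fastforce simp: chain_segments_def integral_segment_def)

lemma standard_element_chain:
  "chain Js G \<Longrightarrow> standard_element q (mset (chain_segments q Js G)) = chain_segments q Js G"
  by (rule standard_element_unique) (rule standard_sequence_chain_segments)

lemma seg_blocks_chain:
  "chain Js G \<Longrightarrow> seg_blocks q (mset (chain_segments q Js G)) = stairs Js G"
  by (simp add: seg_blocks_def standard_element_chain endpoints_chain_segments blocks_stairs)

lemma gamma_of_chain: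
  assumes "chain Js G"
  shows "gamma_of q (mset (chain_segments q Js G)) = G"
proof -
  have "(\<lambda>(i, j). nat (j - i + 1)) = seg_length" by (auto simp: seg_length_def)
  then show ?thesis
    using assms unfolding gamma_of_def
    by (simp add: seg_blocks_chain map_seg_length_stairs chain_def)
qed

lemma f_of_chain:
  "chain Js G \<Longrightarrow> f_of q (mset (chain_segments q Js G)) = rev Js"
  by (simp add: f_of_def seg_blocks_chain map_hd_stairs chain_def)

lemma chain_mem_multisegments_iff:
  assumes "chain Js G"
  shows "mset (chain_segments q Js G) \<in> multisegments q r \<longleftrightarrow> sum_list (map sum_list G) = r"
proof -
  have "map length (chain_segments q Js G) = map seg_length (concat (stairs Js G))"
    using stairs_nondegenerate[OF assms] by (auto simp: chain_segments_def length_segment)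
  then have "(\<Sum>s\<in>#mset (chain_segments q Js G). length s) = sum_list (map sum_list G)"
    using assms unfolding mset_map[symmetric] sum_mset_sum_list
    by (simp only: sum_list_map_seg_length_concat map_seg_length_stairs chain_def)
  moreover have "\<forall>s \<in> set (chain_segments q Js G). integral_segment q s"
    using standard_sequence_chain_segments[OF assms] by (simp add: standard_sequence_def)
  ultimately show ?thesis by (simp add: multisegments_def)
qed

lemma multisegment_eq_chain:
  assumes "S \<in> multisegments q r"
  obtains Js G where "chain Js G" "S = mset (chain_segments q Js G)"
proof -
  have "\<forall>s \<in># S. integral_segment q s" using assms by (simp add: multisegments_def)
  then obtain ss where ss: "mset ss = S" "standard_sequence q ss"
    using standard_element_ex1[OF q_nonzero q_not_root] by blast
  have seg: "fst (endpoints q s) \<le> snd (endpoints q s)"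
    "segment q (fst (endpoints q s)) (snd (endpoints q s)) = s" if "s \<in> set ss" for s
    using that ss(2) endpoints_segment[OF q_nonzero q_not_root]
    by (fastforce simp: standard_sequence_def integral_segment_def)+
  obtain Js G where JG: "chain Js G" "map (endpoints q) ss = concat (stairs Js G)"
    using chain_exists[of "map (endpoints q) ss"] ss(2) seg(1)
    by (auto simp: standard_sequence_iff_successively)
  have "chain_segments q Js G = ss"
    unfolding chain_segments_def JG(2)[symmetric] map_map by (rule map_idI) (simp add: seg(2))
  with JG(1) ss(1) that show thesis by blast
qed

section \<open>Column residual segments\<close>

text \<open>Row \<open>b\<close> of \<open>l\<close>, counted from 0, is column \<open>b + 1\<close> of its conjugate; this column has
  \<open>l ! b\<close> boxes and its residues end at exponent \<open>J + b\<close>, as does entry \<open>b\<close> of the stair.\<close>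

lemma column_segment_conjugate:
  assumes "is_partition l" "b < length l"
  shows "column_segment q (q powi (2 * J)) (conjugate l) (Suc b) =
    segment q (J + int b - int (l ! b) + 1) (J + int b)"
proof -
  have "part (conjugate (conjugate l)) (Suc b) = l ! b"
    using assms by (subst part_conjugate_conjugate) (auto simp: part_def)
  then show ?thesis
    unfolding column_segment_def segment_def
    by (intro nth_equalityI) (auto simp: q_nonzero algebra_simps simp flip: power_int_add)
qed

lemma columns_conjugate:
  assumes "is_partition l"
  shows "map (column_segment q (q powi (2 * J)) (conjugate l)) [1..<Suc (part (conjugate l) 1)] =
    map (\<lambda>p. segment q (fst p) (snd p)) (stair J l)"
  unfolding part_conjugate_1[OF assms]
  by (rule nth_equalityI) 
    (simp_all add: nth_stair column_segment_conjugate[OF assms] del: upt_Suc)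

text \<open>The reversals in \<open>mconjugate\<close>, in the order of \<open>f\<close> and in \<open>column_segments\<close> cancel, so
  the components are traversed in the order of the blocks.\<close>

lemma column_segments_chain:
  assumes "chain Js G"
  shows "column_segments q (mconjugate G) (u_vec q (rev Js)) = chain_segments q Js G"
proof -
  have len: "length G = length Js" and part: "\<forall>l \<in> set G. is_partition l"
    using assms by (auto simp: chain_def)
  have "column_segments q (mconjugate G) (u_vec q (rev Js)) =
      concat (map2 (\<lambda>l J. map (column_segment q (q powi (2 * J)) (conjugate l))
        [1..<Suc (part (conjugate l) 1)]) G Js)"
    unfolding column_segments_def mconjugate_def u_vec_def
    using len by (simp add: zip_rev zip_map_map rev_map case_prod_unfold comp_def del: upt_Suc)
  also have "\<dots> = chain_segments q Js G"
    using len part unfolding chain_segments_def stairs_def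
    by (induction G Js rule: list_induct2) (simp_all add: columns_conjugate del: upt_Suc One_nat_def)
  finally show ?thesis .
qed

end

lemma fstar_eq: "fstar f = map uminus (rev f)"
  by (simp add: fstar_def rev_map)

lemma rev_map_inverse_u_vec: "rev (map inverse (u_vec q f)) = u_vec q (fstar f)"
  by (simp add: u_vec_def fstar_def rev_map comp_def flip: power_int_minus)

theorem proposition4p2p4:
  fixes q :: complex and r :: nat
  assumes "q \<noteq> 0" and "\<forall>n>0. q ^ n \<noteq> 1"
  shows "(\<forall>S \<in> multisegments q r.
            f_of q S \<in> dom_seqs (length (gamma_of q S)) \<and>
            rev (map inverse (u_of q S)) = u_vec q (fstar (f_of q S)) \<and>
            sincere (gamma_of q S) \<and>
            gamma_of q S \<in> standard_multipartitions (fstar (f_of q S)) r \<and>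
            column_segments q (mconjugate (gamma_of q S)) (u_of q S) = standard_element q S)
       \<and> (\<forall>f \<in> all_dom_seqs.
            bij_betw (gamma_of q) (multisegments_with q r f)
              (standard_multipartitions (fstar f) r))"
proof (intro conjI ballI)
  fix S assume S: "S \<in> multisegments q r"
  obtain Js G where ch: "chain Js G" and S_eq: "S = mset (chain_segments q Js G)"
    using multisegment_eq_chain[OF assms S] .
  have G: "gamma_of q S = G" and f: "f_of q S = rev Js"
    unfolding S_eq by (rule gamma_of_chain[OF assms ch], rule f_of_chain[OF assms ch])
  show "f_of q S \<in> dom_seqs (length (gamma_of q S))"
    using ch chain_imp_sorted[OF ch] by (simp add: G f dom_seqs_def chain_def sorted_wrt_rev)
  show "rev (map inverse (u_of q S)) = u_vec q (fstar (f_of q S))"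
    unfolding u_of_def by (rule rev_map_inverse_u_vec)
  have "sum_list l > 0" if "l \<in> set G" for l
    using ch that by (cases l) (force simp: chain_def is_partition_def)+
  then show "sincere (gamma_of q S)" by (simp add: G sincere_def)
  show "gamma_of q S \<in> standard_multipartitions (fstar (f_of q S)) r"
    using S ch unfolding G f fstar_eq rev_rev_ident standard_multipartitions_iff_chain
    by (simp add: S_eq chain_mem_multisegments_iff[OF assms])
  show "column_segments q (mconjugate (gamma_of q S)) (u_of q S) = standard_element q S"
    unfolding u_of_def G f unfolding S_eq
    by (simp add: column_segments_chain[OF assms ch] standard_element_chain[OF assms ch])
next
  fix f :: "int list"
  show "bij_betw (gamma_of q) (multisegments_with q r f) (standard_multipartitions (fstar f) r)"
    \<comment> \<open>The inverse rebuilds the multisegment from the starting exponents that \<open>f\<close> prescribes.\<close>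
  proof (rule bij_betw_byWitness[where f' = "\<lambda>G. mset (chain_segments q (rev f) G)"])
    have fwd: "gamma_of q S \<in> standard_multipartitions (fstar f) r \<and>
        mset (chain_segments q (rev f) (gamma_of q S)) = S"
      if S: "S \<in> multisegments_with q r f" for S
    proof -
      have S': "S \<in> multisegments q r" and f: "f_of q S = f"
        using S u_vec_eq_iff[OF assms] by (auto simp: multisegments_with_def u_of_def)
      obtain Js G where ch: "chain Js G" and S_eq: "S = mset (chain_segments q Js G)"
        using multisegment_eq_chain[OF assms S'] .
      have "Js = rev f" using f f_of_chain[OF assms ch] S_eq by (metis rev_rev_ident)
      moreover have "gamma_of q S = G" unfolding S_eq by (rule gamma_of_chain[OF assms ch])
      ultimately show ?thesis
        using ch S' unfolding fstar_eq standard_multipartitions_iff_chain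
        by (simp add: S_eq chain_mem_multisegments_iff[OF assms])
    qed
    then show "\<forall>S \<in> multisegments_with q r f.
        mset (chain_segments q (rev f) (gamma_of q S)) = S"
      and "gamma_of q ` multisegments_with q r f \<subseteq> standard_multipartitions (fstar f) r"
      by auto
    have ch: "chain (rev f) G \<and> sum_list (map sum_list G) = r"
      if "G \<in> standard_multipartitions (fstar f) r" for G
      using that unfolding fstar_eq standard_multipartitions_iff_chain .
    show "\<forall>G \<in> standard_multipartitions (fstar f) r.
        gamma_of q (mset (chain_segments q (rev f) G)) = G"
      using ch gamma_of_chain[OF assms] by blast
    show "(\<lambda>G. mset (chain_segments q (rev f) G)) ` standard_multipartitions (fstar f) r
        \<subseteq> multisegments_with q r f"
      using ch by (auto simp: multisegments_with_def u_of_def f_of_chain[OF assms]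
          chain_mem_multisegments_iff[OF assms])
  qed
qed

end
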